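(* Let $K$ be a field, $P=K[x_1,\dots,x_n]$, let $F=(f_1,\dots,f_k)$ be a tuple of polynomials in $P$, let $I\subsetneq P$ be an ideal, and let $G$ be a subgroup of $K^\times$. (a) If $I:\langle f_1\cdots f_k\rangle^\infty=I$, then the residue classes of $f_1,\dots,f_k$ are non-zerodivisors in $P/I$. (b) The set $$\Lambda=\{a\in\mathbb Z^k\mid F^{a^+}-g_aF^{a^-}\in I\text{ for some }g_a\in G\}$$ is a lattice. (c) If the residue classes of the elements $f_1,\dots,f_k$ are non-zerodivisors in $P/I$, then the map $\rho:\Lambda\to G$ given by $\rho(a)=g_a$ for all $a\in\Lambda$ is a well-defined group homomorphism.
   Context: For $a\in\mathbb Z^k$ write $a=a^+-a^-$ with $a_i^+=\max\{a_i,0\}$ and $a_i^-=\max\{-a_i,0\}$. For $b\in\mathbb N^k$ write $F^b=f_1^{b_1}\cdots f_k^{b_k}$. A lattice here is a subgroup of $\mathbb Z^k$. For an ideal $I$ and a polynomial $f$, $I:\langle f\rangle^\infty=\bigcup_{i\ge1}(I:\langle f\rangle^i)$.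
   Formalization: Part (b) is proved assuming, as in (c), that the residue classes of f_1,…,f_k are non-zerodivisors in P/I; without this it is false: for F=(x,y), I=⟨x−y²,y−x²⟩, Λ contains (1,−2) and (−2,1) but not (−1,−1). *)

theory Defs
  imports
    "HOL-Library.Poly_Mapping"
    "HOL-Algebra.Algebraic_Closure_Type"
    "HOL-Algebra.Ideal_Product"
    "HOL-Algebra.Product_Groups"
begin

text \<open>Monomials are finitely supported exponent vectors; the variable \<open>x\<^sub>i\<close> is
  \<open>Poly_Mapping.single (Poly_Mapping.single i 1) 1\<close>.\<close>

type_synonym 'a mpoly = "(nat \<Rightarrow>\<^sub>0 nat) \<Rightarrow>\<^sub>0 'a"

definition mpoly_ring :: "nat \<Rightarrow> 'a::field mpoly ring" where
  "mpoly_ring n =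
    \<lparr>carrier = {p. \<forall>m \<in> Poly_Mapping.keys p. Poly_Mapping.keys m \<subseteq> {1..n}},
     monoid.mult = (*), one = 1, ring.zero = 0, add = (+)\<rparr>"

definition mpoly_const :: "'a::field \<Rightarrow> 'a mpoly" where
  "mpoly_const c = Poly_Mapping.single 0 c"

definition field_units :: "'a::field monoid" where
  "field_units = units_of (ring_of_type_algebra :: 'a ring)"

text \<open>The elements of \<open>int_lattice k\<close> are the integer tuples indexed by \<open>{1..k}\<close>,
  extended by \<open>undefined\<close> outside that set.\<close>

definition int_lattice :: "nat \<Rightarrow> (nat \<Rightarrow> int) monoid" where
  "int_lattice k = product_group {1..k} (\<lambda>_. integer_group)"

definition pos_part :: "(nat \<Rightarrow> int) \<Rightarrow> nat \<Rightarrow> nat" where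
  "pos_part a i = nat (max (a i) 0)"

definition neg_part :: "(nat \<Rightarrow> int) \<Rightarrow> nat \<Rightarrow> nat" where
  "neg_part a i = nat (max (- a i) 0)"

definition tuple_power ::
  "('b, 'c) ring_scheme \<Rightarrow> nat \<Rightarrow> (nat \<Rightarrow> 'b) \<Rightarrow> (nat \<Rightarrow> nat) \<Rightarrow> 'b" where
  "tuple_power R k f b = (\<Otimes>\<^bsub>R\<^esub>i \<in> {1..k}. f i [^]\<^bsub>R\<^esub> b i)"

definition ideal_colon :: "('b, 'c) ring_scheme \<Rightarrow> 'b set \<Rightarrow> 'b set \<Rightarrow> 'b set" where
  "ideal_colon R I J = {r \<in> carrier R. \<forall>s \<in> J. r \<otimes>\<^bsub>R\<^esub> s \<in> I}"

definition saturation :: "('b, 'c) ring_scheme \<Rightarrow> 'b set \<Rightarrow> 'b \<Rightarrow> 'b set" where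
  "saturation R I r =
    (\<Union>i \<in> {1::nat..}. ideal_colon R I ((Idl\<^bsub>R\<^esub> {r}) [^]\<^bsub>ideals_set R\<^esub> i))"

definition non_zerodivisor :: "('b, 'c) ring_scheme \<Rightarrow> 'b \<Rightarrow> bool" where
  "non_zerodivisor R r \<longleftrightarrow>
    r \<in> carrier R \<and> (\<forall>s \<in> carrier R. r \<otimes>\<^bsub>R\<^esub> s = \<zero>\<^bsub>R\<^esub> \<longrightarrow> s = \<zero>\<^bsub>R\<^esub>)"

definition residues_non_zerodivisors ::
  "('b, 'c) ring_scheme \<Rightarrow> nat \<Rightarrow> (nat \<Rightarrow> 'b) \<Rightarrow> 'b set \<Rightarrow> bool" where
  "residues_non_zerodivisors R k f I \<longleftrightarrow>
    (\<forall>i \<in> {1..k}. non_zerodivisor (R Quot I) (I +>\<^bsub>R\<^esub> f i))"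

definition exponent_coeff ::
  "nat \<Rightarrow> nat \<Rightarrow> (nat \<Rightarrow> 'a::field mpoly) \<Rightarrow> 'a mpoly set \<Rightarrow> (nat \<Rightarrow> int) \<Rightarrow> 'a \<Rightarrow> bool" where
  "exponent_coeff n k f I a g \<longleftrightarrow>
    tuple_power (mpoly_ring n) k f (pos_part a)
      \<ominus>\<^bsub>mpoly_ring n\<^esub> (mpoly_const g \<otimes>\<^bsub>mpoly_ring n\<^esub> tuple_power (mpoly_ring n) k f (neg_part a))
    \<in> I"

text \<open>This set need not be a subgroup of \<open>int_lattice k\<close> unless one may cancel the \<open>f\<^sub>i\<close>
  modulo \<open>I\<close>.  For \<open>f = (x, y)\<close>, \<open>I = \<langle>x - y\<^sup>2, y - x\<^sup>2\<rangle>\<close> and any \<open>G\<close> it contains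
  \<open>(1, -2)\<close> and \<open>(-2, 1)\<close>, but not their sum \<open>(-1, -1)\<close>: every element of \<open>I\<close> vanishes
  at the origin, whereas \<open>1 - g x y\<close> does not.\<close>

definition exponent_lattice ::
  "nat \<Rightarrow> nat \<Rightarrow> (nat \<Rightarrow> 'a::field mpoly) \<Rightarrow> 'a mpoly set \<Rightarrow> 'a set \<Rightarrow> (nat \<Rightarrow> int) set" where
  "exponent_lattice n k f I G =
    {a \<in> carrier (int_lattice k). \<exists>g \<in> G. exponent_coeff n k f I a g}"

definition exponent_character ::
  "nat \<Rightarrow> nat \<Rightarrow> (nat \<Rightarrow> 'a::field mpoly) \<Rightarrow> 'a mpoly set \<Rightarrow> 'a set \<Rightarrow> (nat \<Rightarrow> int) \<Rightarrow> 'a" where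
  "exponent_character n k f I G a = (THE g. g \<in> G \<and> exponent_coeff n k f I a g)"

end

theory Submission
  imports Defs
begin

text \<open>
  Write \<open>P\<close> for the polynomial ring and \<open>p \<equiv> q\<close> for \<open>p - q \<in> I\<close>.

  Part (a): if \<open>f\<^sub>i s \<in> I\<close>, then \<open>s\<close> multiplies the whole product \<open>f\<^sub>1 \<cdots> f\<^sub>k\<close> into \<open>I\<close>, so \<open>s\<close> already
  lies in the first stage \<open>I : \<langle>f\<^sub>1 \<cdots> f\<^sub>k\<rangle>\<close> of the saturation, which is \<open>I\<close>.

  Parts (b) and (c) rest on freeing the exponents from the normal form \<open>a = a\<^sup>+ - a\<^sup>-\<close>.  Call
  \<open>F\<^sup>u \<equiv> g F\<^sup>v\<close> a relation with coefficient \<open>g\<close>, for arbitrary exponents \<open>u, v \<in> \<nat>\<^sup>k\<close>.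
  If \<open>u - v = a\<close>, then \<open>u = a\<^sup>+ + w\<close> and \<open>v = a\<^sup>- + w\<close> for some \<open>w \<in> \<nat>\<^sup>k\<close>, and as \<open>F\<^sup>w\<close>
  may be cancelled modulo \<open>I\<close>, this relation holds exactly when \<open>F\<^bsup>a+\<^esup> \<equiv> g F\<^bsup>a-\<^esup>\<close> does
  (\<open>exponent_coeff_iff_relation\<close>).  Hence membership in \<open>\<Lambda>\<close> may be tested on any representation
  of \<open>a\<close> as a difference, in particular for \<open>a + b\<close> on \<open>a\<^sup>+ + b\<^sup>+\<close> and \<open>a\<^sup>- + b\<^sup>-\<close>, which in general
  exceed the positive and negative parts of \<open>a + b\<close> by a common summand.
  The group structure is now visible: relations multiply
  (\<open>relation_mult\<close>), which gives closure under addition with coefficient \<open>g h\<close>, and they can be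
  reversed (\<open>relation_swap\<close>), which gives closure under negation with coefficient \<open>g\<^sup>-\<^sup>1\<close>.
  The coefficient is determined by \<open>a\<close>: two coefficients \<open>g, h\<close> give \<open>(h - g) F\<^sup>v \<in> I\<close>, hence
  \<open>h - g \<in> I\<close> by cancellation, and a proper ideal contains no nonzero constant.
\<close>

section \<open>Saturation and non-zerodivisors modulo an ideal\<close>

lemma non_zerodivisor_Quot_iff:
  assumes "ideal I R" and r: "r \<in> carrier R"
  shows "non_zerodivisor (R Quot I) (I +>\<^bsub>R\<^esub> r) \<longleftrightarrow>
    (\<forall>s \<in> carrier R. r \<otimes>\<^bsub>R\<^esub> s \<in> I \<longrightarrow> s \<in> I)"
proof -
  interpret ideal I R by fact
  have coset_eq_I: "I +>\<^bsub>R\<^esub> s = I \<longleftrightarrow> s \<in> I" if "s \<in> carrier R" for s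
    using that a_coset_join1[OF _ that a_subgroup] a_rcos_zero[OF \<open>ideal I R\<close>] by blast
  have "carrier (R Quot I) = (\<lambda>s. I +>\<^bsub>R\<^esub> s) ` carrier R"
    by (auto simp: FactRing_def A_RCOSETS_def')
  moreover have "(I +>\<^bsub>R\<^esub> r) \<otimes>\<^bsub>R Quot I\<^esub> (I +>\<^bsub>R\<^esub> s) = I +>\<^bsub>R\<^esub> (r \<otimes>\<^bsub>R\<^esub> s)"
    if "s \<in> carrier R" for s
    using rcoset_mult_add[OF r that] by (simp add: FactRing_def)
  moreover have "\<zero>\<^bsub>R Quot I\<^esub> = I"
    by (simp add: FactRing_def)
  ultimately show ?thesis
    using r by (auto simp: non_zerodivisor_def coset_eq_I)
qed

lemma ideals_set_pow_one:
  assumes "cring R" "ideal J R"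
  shows "J [^]\<^bsub>ideals_set R\<^esub> (1::nat) = J"
proof -
  interpret cring R by fact
  interpret S: semiring "ideals_set R"
    by (rule ideals_set_is_semiring)
  show ?thesis
    using assms(2) S.nat_pow_eone[of J] by (simp add: ideals_set_def)
qed

text \<open>An element that multiplies \<open>r\<close> into \<open>I\<close> multiplies every multiple of \<open>r\<close> into \<open>I\<close>, so it
  enters the saturation at its first step \<open>I : \<langle>r\<rangle>\<close>.\<close>

lemma mem_saturation:
  assumes "cring R" "ideal I R" "r \<in> carrier R" "s \<in> carrier R" "s \<otimes>\<^bsub>R\<^esub> r \<in> I"
  shows "s \<in> saturation R I r"
proof -
  interpret cring R by fact
  interpret I: ideal I R by fact
  have "s \<otimes>\<^bsub>R\<^esub> t \<in> I" if "t \<in> Idl\<^bsub>R\<^esub> {r}" for t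
  proof -
    have "t \<in> PIdl\<^bsub>R\<^esub> r"
      using that cgenideal_eq_genideal[OF assms(3)] by simp
    then obtain c where c: "c \<in> carrier R" "t = c \<otimes>\<^bsub>R\<^esub> r"
      by (auto simp: cgenideal_def)
    then have "s \<otimes>\<^bsub>R\<^esub> t = c \<otimes>\<^bsub>R\<^esub> (s \<otimes>\<^bsub>R\<^esub> r)"
      using assms(3,4) by (simp add: m_lcomm)
    then show ?thesis
      using I.I_l_closed[OF assms(5) c(1)] by simp
  qed
  then have "s \<in> ideal_colon R I ((Idl\<^bsub>R\<^esub> {r}) [^]\<^bsub>ideals_set R\<^esub> (1::nat))"
    using assms(3,4) ideals_set_pow_one[OF assms(1) genideal_ideal, of "{r}"]
    by (simp add: ideal_colon_def)
  then show ?thesis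
    unfolding saturation_def by blast
qed

lemma residues_non_zerodivisors_if_saturated:
  assumes "cring R" "ideal I R" and f: "f \<in> {1..k} \<rightarrow> carrier R"
    and sat: "saturation R I (\<Otimes>\<^bsub>R\<^esub>i \<in> {1..k}. f i) = I"
  shows "residues_non_zerodivisors R k f I"
proof -
  interpret cring R by fact
  interpret I: ideal I R by fact
  have cancel: "s \<in> I" if i: "i \<in> {1..k}" and s: "s \<in> carrier R" "f i \<otimes>\<^bsub>R\<^esub> s \<in> I" for i s
  proof -
    define q where "q = (\<Otimes>\<^bsub>R\<^esub>j \<in> {1..k} - {i}. f j)"
    have fi: "f i \<in> carrier R" and q: "q \<in> carrier R"
      using f i by (auto simp: q_def intro!: finprod_closed)
    have split: "(\<Otimes>\<^bsub>R\<^esub>j \<in> {1..k}. f j) = f i \<otimes>\<^bsub>R\<^esub> q"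
      using finprod_insert[of "{1..k} - {i}" i f] f i
      by (auto simp: q_def insert_absorb Pi_iff)
    have "s \<otimes>\<^bsub>R\<^esub> (f i \<otimes>\<^bsub>R\<^esub> q) = q \<otimes>\<^bsub>R\<^esub> (f i \<otimes>\<^bsub>R\<^esub> s)"
      using fi q s(1) by (simp add: m_ac)
    then have "s \<otimes>\<^bsub>R\<^esub> (\<Otimes>\<^bsub>R\<^esub>j \<in> {1..k}. f j) \<in> I"
      unfolding split using I.I_l_closed[OF s(2) q] by simp
    then have "s \<in> saturation R I (\<Otimes>\<^bsub>R\<^esub>j \<in> {1..k}. f j)"
      using mem_saturation[OF assms(1,2) _ s(1)] fi q unfolding split by blast
    then show ?thesis
      by (simp only: sat)
  qed
  have "non_zerodivisor (R Quot I) (I +>\<^bsub>R\<^esub> f i)" if "i \<in> {1..k}" for i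
    unfolding non_zerodivisor_Quot_iff[OF assms(2) funcset_mem[OF f that]]
    using cancel[OF that] by blast
  then show ?thesis
    unfolding residues_non_zerodivisors_def by blast
qed

section \<open>The polynomial ring as a subring of all polynomials\<close>

text \<open>The operations of \<open>mpoly_ring n\<close> are those of the type of polynomials in countably many
  variables, so that computations can be carried out in that commutative ring type.\<close>

lemma mpoly_ring_carrier_iff:
  "p \<in> carrier (mpoly_ring n) \<longleftrightarrow> (\<forall>m \<in> Poly_Mapping.keys p. Poly_Mapping.keys m \<subseteq> {1..n})"
  by (simp add: mpoly_ring_def)

lemma mpoly_ring_simps [simp]:
  "p \<otimes>\<^bsub>mpoly_ring n\<^esub> q = p * q" "p \<oplus>\<^bsub>mpoly_ring n\<^esub> q = p + q"
  "\<one>\<^bsub>mpoly_ring n\<^esub> = 1" "\<zero>\<^bsub>mpoly_ring n\<^esub> = 0"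
  by (simp_all add: mpoly_ring_def)

lemma mpoly_const_carrier: "mpoly_const c \<in> carrier (mpoly_ring n)"
  by (auto simp: mpoly_ring_carrier_iff mpoly_const_def)

lemma mpoly_ring_uminus_carrier:
  "p \<in> carrier (mpoly_ring n) \<Longrightarrow> - p \<in> carrier (mpoly_ring n)"
  by (simp add: mpoly_ring_carrier_iff in_keys_iff)

lemma cring_mpoly_ring: "cring (mpoly_ring n :: 'a::field mpoly ring)"
proof (rule cringI)
  have sum: "p + q \<in> carrier (mpoly_ring n)"
    if "p \<in> carrier (mpoly_ring n)" "q \<in> carrier (mpoly_ring n)" for p q :: "'a mpoly"
    using that keys_add[of p q] unfolding mpoly_ring_carrier_iff by blast
  have mult: "p * q \<in> carrier (mpoly_ring n)"
    if "p \<in> carrier (mpoly_ring n)" "q \<in> carrier (mpoly_ring n)" for p q :: "'a mpoly"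
    unfolding mpoly_ring_carrier_iff
  proof
    fix m assume "m \<in> Poly_Mapping.keys (p * q)"
    then obtain a b where "m = a + b" "a \<in> Poly_Mapping.keys p" "b \<in> Poly_Mapping.keys q"
      using keys_mult[of p q] by blast
    then show "Poly_Mapping.keys m \<subseteq> {1..n}"
      using that keys_add[of a b] unfolding mpoly_ring_carrier_iff by blast
  qed
  have zero: "(0::'a mpoly) \<in> carrier (mpoly_ring n)"
    and one: "(1::'a mpoly) \<in> carrier (mpoly_ring n)"
    by (simp_all add: mpoly_ring_carrier_iff)
  show "abelian_group (mpoly_ring n :: 'a mpoly ring)"
  proof (rule abelian_groupI)
    fix p :: "'a mpoly" assume "p \<in> carrier (mpoly_ring n)"
    then show "\<exists>q \<in> carrier (mpoly_ring n). q \<oplus>\<^bsub>mpoly_ring n\<^esub> p = \<zero>\<^bsub>mpoly_ring n\<^esub>"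
      by (rule_tac x = "- p" in bexI) (simp_all add: mpoly_ring_uminus_carrier)
  qed (simp_all add: sum zero add.assoc add.commute)
  show "comm_monoid (mpoly_ring n :: 'a mpoly ring)"
    by (rule comm_monoidI) (simp_all add: mult one mult.assoc mult.commute)
qed (simp add: distrib_right)

lemma mpoly_ring_minus [simp]:
  assumes "q \<in> carrier (mpoly_ring n)"
  shows "p \<ominus>\<^bsub>mpoly_ring n\<^esub> q = p - q"
proof -
  interpret cring "mpoly_ring n" by (rule cring_mpoly_ring)
  have "\<ominus>\<^bsub>mpoly_ring n\<^esub> q = - q"
    using assms by (intro minus_equality) (auto intro: mpoly_ring_uminus_carrier)
  then show ?thesis
    by (simp add: a_minus_def)
qed

lemma tuple_power_mpoly_ring:
  assumes "f \<in> {1..k} \<rightarrow> carrier (mpoly_ring n)"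
  shows "tuple_power (mpoly_ring n) k f b \<in> carrier (mpoly_ring n)"
    and "tuple_power (mpoly_ring n) k f b = (\<Prod>i \<in> {1..k}. f i ^ b i)"
proof -
  interpret cring "mpoly_ring n" by (rule cring_mpoly_ring)
  have pow: "x [^]\<^bsub>mpoly_ring n\<^esub> j = x ^ j" for x :: "'a mpoly" and j :: nat
    by (induction j) (simp_all add: mult.commute)
  have closed: "(\<lambda>i. f i [^]\<^bsub>mpoly_ring n\<^esub> b i) \<in> {1..k} \<rightarrow> carrier (mpoly_ring n)"
    using assms by (intro Pi_I nat_pow_closed) auto
  then show "tuple_power (mpoly_ring n) k f b \<in> carrier (mpoly_ring n)"
    unfolding tuple_power_def by (rule finprod_closed)
  have "finprod (mpoly_ring n) h A = prod h A"
    if "finite A" "h \<in> A \<rightarrow> carrier (mpoly_ring n)" for h :: "nat \<Rightarrow> 'a mpoly" and A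
    using that by (induction rule: finite_induct) (auto simp: finprod_insert Pi_iff)
  from this[OF _ closed] show "tuple_power (mpoly_ring n) k f b = (\<Prod>i \<in> {1..k}. f i ^ b i)"
    by (simp add: tuple_power_def pow)
qed

lemma mpoly_const_simps:
  "mpoly_const (g * h) = mpoly_const g * mpoly_const h"
  "mpoly_const (g - h) = mpoly_const g - mpoly_const h"
  "mpoly_const 1 = 1"
  by (simp_all add: mpoly_const_def mult_single single_diff)

section \<open>Binomial relations modulo an ideal\<close>

locale cancellable_tuple =
  fixes n k :: nat and f :: "nat \<Rightarrow> 'a::field mpoly" and I :: "'a mpoly set"
  assumes f_carrier: "f \<in> {1..k} \<rightarrow> carrier (mpoly_ring n)"
    and ideal_I: "ideal I (mpoly_ring n)"
    and proper: "I \<noteq> carrier (mpoly_ring n)"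
    and residues: "residues_non_zerodivisors (mpoly_ring n) k f I"
begin

abbreviation P :: "'a mpoly set" where
  "P \<equiv> carrier (mpoly_ring n)"

definition monom :: "(nat \<Rightarrow> nat) \<Rightarrow> 'a mpoly" where
  "monom u = (\<Prod>i \<in> {1..k}. f i ^ u i)"

definition relation :: "(nat \<Rightarrow> nat) \<Rightarrow> (nat \<Rightarrow> nat) \<Rightarrow> 'a \<Rightarrow> bool" where
  "relation u v g \<longleftrightarrow> monom u - mpoly_const g * monom v \<in> I"

sublocale R: cring "mpoly_ring n"
  by (rule cring_mpoly_ring)

sublocale I: ideal I "mpoly_ring n"
  by (rule ideal_I)

lemma P_mult: "p \<in> P \<Longrightarrow> q \<in> P \<Longrightarrow> p * q \<in> P"
  using R.m_closed by simp

lemma P_diff: "p \<in> P \<Longrightarrow> q \<in> P \<Longrightarrow> p - q \<in> P"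
  using R.minus_closed[of p q] by simp

lemma P_power: "p \<in> P \<Longrightarrow> p ^ j \<in> P"
  using R.one_closed by (induction j) (auto intro: P_mult)

lemma I_add: "p \<in> I \<Longrightarrow> q \<in> I \<Longrightarrow> p + q \<in> I"
  using I.a_closed by simp

lemma I_mult: "c \<in> P \<Longrightarrow> p \<in> I \<Longrightarrow> c * p \<in> I"
  using I.I_l_closed by simp

lemma monom_carrier: "monom u \<in> P"
  using tuple_power_mpoly_ring[OF f_carrier, of u] by (simp add: monom_def)

lemma monom_add: "monom (\<lambda>i. u i + v i) = monom u * monom v"
  by (simp add: monom_def power_add prod.distrib)

lemma relation_cong:
  assumes "\<And>i. i \<in> {1..k} \<Longrightarrow> u i = u' i" "\<And>i. i \<in> {1..k} \<Longrightarrow> v i = v' i"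
  shows "relation u v g \<longleftrightarrow> relation u' v' g"
  using assms by (simp add: relation_def monom_def)

lemma monom_cancel:
  assumes "s \<in> P" "monom u * s \<in> I"
  shows "s \<in> I"
proof -
  have f_in: "f i \<in> P" if "i \<in> {1..k}" for i
    using f_carrier that by blast
  have cancel: "t \<in> I" if "i \<in> {1..k}" "t \<in> P" "f i * t \<in> I" for i t
  proof -
    have "non_zerodivisor (mpoly_ring n Quot I) (I +>\<^bsub>mpoly_ring n\<^esub> f i)"
      using residues that(1) unfolding residues_non_zerodivisors_def by blast
    then show ?thesis
      using that(2,3) unfolding non_zerodivisor_Quot_iff[OF ideal_I f_in[OF that(1)]] by simp
  qed
  have cancel_power: "t \<in> I" if "i \<in> {1..k}" "t \<in> P" "f i ^ j * t \<in> I" for i j t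
    using that
  proof (induction j arbitrary: t)
    case (Suc j)
    have "f i ^ j * (f i * t) \<in> I"
      using Suc.prems(3) by (simp add: ac_simps)
    then have "f i * t \<in> I"
      by (rule Suc.IH[OF Suc.prems(1) P_mult[OF f_in[OF Suc.prems(1)] Suc.prems(2)]])
    then show ?case
      using Suc.prems cancel by blast
  qed simp
  have "t \<in> I"
    if "A \<subseteq> {1..k}" "t \<in> P" "(\<Prod>i \<in> A. f i ^ u i) * t \<in> I" for A t
    using finite_subset[OF that(1) finite_atLeastAtMost] that
  proof (induction A arbitrary: t rule: finite_induct)
    case (insert i A)
    have "f i ^ u i * t \<in> P"
      using f_in[of i] insert.prems(1,2) by (simp add: P_power P_mult)
    moreover have "(\<Prod>j \<in> A. f j ^ u j) * (f i ^ u i * t) \<in> I"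
      using insert.prems(3) insert.hyps by (simp add: ac_simps)
    ultimately have "f i ^ u i * t \<in> I"
      using insert.IH[of "f i ^ u i * t"] insert.prems(1) by simp
    then show ?case
      using cancel_power[of i t "u i"] insert.prems by simp
  qed simp
  from this[OF subset_refl] show ?thesis
    using assms by (simp add: monom_def)
qed

lemma relation_mult:
  assumes "relation u v g" "relation u' v' h"
  shows "relation (\<lambda>i. u i + u' i) (\<lambda>i. v i + v' i) (g * h)"
proof -
  have "monom u * monom u' - mpoly_const (g * h) * (monom v * monom v')
    = monom u' * (monom u - mpoly_const g * monom v)
      + (mpoly_const g * monom v) * (monom u' - mpoly_const h * monom v')"
    by (simp add: mpoly_const_simps algebra_simps)
  moreover have "\<dots> \<in> I"
    using assms unfolding relation_def
    by (intro I_add I_mult monom_carrier P_mult mpoly_const_carrier)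
  ultimately show ?thesis
    by (simp add: relation_def monom_add)
qed

lemma relation_swap:
  assumes "relation u v g" "g \<noteq> 0"
  shows "relation v u (inverse g)"
proof -
  have inv: "mpoly_const (inverse g) * mpoly_const g = 1"
    using assms(2) by (simp add: mpoly_const_simps(3) flip: mpoly_const_simps(1))
  have "monom v - mpoly_const (inverse g) * monom u
    = (mpoly_const (inverse g) * mpoly_const g) * monom v - mpoly_const (inverse g) * monom u"
    unfolding inv by simp
  also have "\<dots> = - mpoly_const (inverse g) * (monom u - mpoly_const g * monom v)"
    by (simp add: algebra_simps)
  finally have eq: "monom v - mpoly_const (inverse g) * monom u
    = - mpoly_const (inverse g) * (monom u - mpoly_const g * monom v)" .
  show ?thesis
    unfolding relation_def eq
    by (rule I_mult[OF mpoly_ring_uminus_carrier[OF mpoly_const_carrier]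
          assms(1)[unfolded relation_def]])
qed

lemma relation_add_iff:
  "relation (\<lambda>i. u i + w i) (\<lambda>i. v i + w i) g \<longleftrightarrow> relation u v g"
proof -
  have "monom u * monom w - mpoly_const g * (monom v * monom w)
    = monom w * (monom u - mpoly_const g * monom v)"
    by (simp add: algebra_simps)
  then show ?thesis
    unfolding relation_def monom_add
    using I_mult[OF monom_carrier] monom_cancel
      P_diff[OF monom_carrier P_mult[OF mpoly_const_carrier monom_carrier]] by metis
qed

text \<open>Two coefficients of the same relation differ by a constant that cancellation puts into \<open>I\<close>; were
  it nonzero, it would be a unit and \<open>I\<close> would be the whole ring.\<close>

lemma relation_unique:
  assumes "relation u v g" "relation u v h"
  shows "g = h"
proof (rule ccontr)
  assume "g \<noteq> h"
  have "monom v * mpoly_const (h - g)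
    = (monom u - mpoly_const g * monom v) + (- 1) * (monom u - mpoly_const h * monom v)"
    by (simp add: mpoly_const_simps algebra_simps)
  moreover have "\<dots> \<in> I"
    using assms R.one_closed unfolding relation_def
    by (intro I_add I_mult mpoly_ring_uminus_carrier) auto
  ultimately have "mpoly_const (h - g) \<in> I"
    using monom_cancel mpoly_const_carrier by metis
  then have "mpoly_const (inverse (h - g)) * mpoly_const (h - g) \<in> I"
    by (intro I_mult mpoly_const_carrier)
  moreover have "mpoly_const (inverse (h - g)) * mpoly_const (h - g) = 1"
    using \<open>g \<noteq> h\<close> by (simp add: mpoly_const_simps(3) flip: mpoly_const_simps(1))
  ultimately show False
    using I.one_imp_carrier proper by simp
qed

text \<open>By cancellation, the condition that defines \<open>\<Lambda>\<close> does not depend on how \<open>a\<close> is written as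
  a difference of exponent vectors.\<close>

lemma exponent_coeff_iff_relation:
  assumes "\<And>i. i \<in> {1..k} \<Longrightarrow> a i = int (u i) - int (v i)"
  shows "exponent_coeff n k f I a g \<longleftrightarrow> relation u v g"
proof -
  \<comment> \<open>No truncation occurs on \<open>{1..k}\<close>: there \<open>u i\<close> is at least the positive part of
    \<open>u i - v i\<close>.\<close>
  define w where "w i = u i - pos_part a i" for i
  have "relation u v g
    \<longleftrightarrow> relation (\<lambda>i. pos_part a i + w i) (\<lambda>i. neg_part a i + w i) g"
    by (rule relation_cong) (use assms in \<open>auto simp: w_def pos_part_def neg_part_def\<close>)
  also have "\<dots> \<longleftrightarrow> exponent_coeff n k f I a g"
    unfolding relation_add_iff exponent_coeff_def relation_def
      tuple_power_mpoly_ring(2)[OF f_carrier] monom_def[symmetric]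
    by (simp add: mpoly_ring_minus[OF P_mult[OF mpoly_const_carrier monom_carrier]])
  finally show ?thesis ..
qed

lemma exponent_coeff_relation:
  "exponent_coeff n k f I a g \<longleftrightarrow> relation (pos_part a) (neg_part a) g"
  by (rule exponent_coeff_iff_relation) (auto simp: pos_part_def neg_part_def)

lemma exponent_coeff_unique:
  "exponent_coeff n k f I a g \<Longrightarrow> exponent_coeff n k f I a h \<Longrightarrow> g = h"
  unfolding exponent_coeff_relation by (rule relation_unique)

lemma exponent_coeff_zero:
  assumes "\<And>i. i \<in> {1..k} \<Longrightarrow> a i = 0"
  shows "exponent_coeff n k f I a 1"
proof -
  have "relation (\<lambda>_. 0) (\<lambda>_. 0) 1"
    using I.zero_closed by (simp add: relation_def mpoly_const_simps)
  then show ?thesis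
    using assms by (subst exponent_coeff_iff_relation[of _ "\<lambda>_. 0" "\<lambda>_. 0"]) auto
qed

lemma exponent_coeff_add:
  assumes "exponent_coeff n k f I a g" "exponent_coeff n k f I b h"
    and "\<And>i. i \<in> {1..k} \<Longrightarrow> c i = a i + b i"
  shows "exponent_coeff n k f I c (g * h)"
  using relation_mult[OF assms(1,2)[unfolded exponent_coeff_relation]]
  by (subst exponent_coeff_iff_relation) (auto simp: assms(3) pos_part_def neg_part_def)

lemma exponent_coeff_uminus:
  assumes "exponent_coeff n k f I a g" "g \<noteq> 0"
    and "\<And>i. i \<in> {1..k} \<Longrightarrow> c i = - a i"
  shows "exponent_coeff n k f I c (inverse g)"
  using relation_swap[OF assms(1)[unfolded exponent_coeff_relation] assms(2)]
  by (subst exponent_coeff_iff_relation) (auto simp: assms(3) pos_part_def neg_part_def)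

end

section \<open>The exponent lattice and its character\<close>

lemma group_int_lattice: "group (int_lattice k)"
  by (simp add: int_lattice_def)

lemma int_lattice_simps:
  "a \<otimes>\<^bsub>int_lattice k\<^esub> b = (\<lambda>i\<in>{1..k}. a i + b i)"
  "\<one>\<^bsub>int_lattice k\<^esub> = (\<lambda>i\<in>{1..k}. 0)"
  "a \<in> carrier (int_lattice k) \<Longrightarrow> inv\<^bsub>int_lattice k\<^esub> a = (\<lambda>i\<in>{1..k}. - a i)"
  by (simp_all add: int_lattice_def)

lemma group_field_units: "group (field_units :: 'a::field monoid)"
proof -
  interpret ring "ring_of_type_algebra :: 'a ring" ..
  show ?thesis
    unfolding field_units_def by (rule units_group)
qed

lemma field_units_simps:
  "carrier (field_units :: 'a::field monoid) = - {0}"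
  "(g::'a) \<otimes>\<^bsub>field_units\<^esub> h = g * h"
  "\<one>\<^bsub>field_units\<^esub> = (1::'a)"
proof -
  interpret Algebra: Ring.field "ring_of_type_algebra :: 'a ring" ..
  show "carrier (field_units :: 'a monoid) = - {0}"
    using Algebra.field_Units
    by (auto simp: field_units_def units_of_carrier ring_of_type_algebra_def)
qed (simp_all add: field_units_def units_of_def ring_of_type_algebra_def)

lemma field_units_inv:
  assumes "(g::'a::field) \<noteq> 0"
  shows "inv\<^bsub>field_units\<^esub> g = inverse g"
  using assms by (intro group.inv_equality[OF group_field_units]) (auto simp: field_units_simps)

context cancellable_tuple
begin

lemma subgroup_exponent_lattice:
  assumes "subgroup G field_units"
  shows "subgroup (exponent_lattice n k f I G) (int_lattice k)"
proof -
  interpret L: group "int_lattice k" by (rule group_int_lattice)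
  have nonzero: "g \<noteq> 0" if "g \<in> G" for g
    using subgroup.mem_carrier[OF assms that] by (simp add: field_units_simps)
  show ?thesis
  proof (rule L.subgroupI)
    show "exponent_lattice n k f I G \<subseteq> carrier (int_lattice k)"
      by (auto simp: exponent_lattice_def)
  next
    have "exponent_coeff n k f I \<one>\<^bsub>int_lattice k\<^esub> 1"
      by (rule exponent_coeff_zero) (simp add: int_lattice_simps)
    then have "\<one>\<^bsub>int_lattice k\<^esub> \<in> exponent_lattice n k f I G"
      using subgroup.one_closed[OF assms] L.one_closed
      by (auto simp: exponent_lattice_def field_units_simps)
    then show "exponent_lattice n k f I G \<noteq> {}"
      by blast
  next
    fix a assume "a \<in> exponent_lattice n k f I G"
    then obtain g where a: "a \<in> carrier (int_lattice k)"
      and g: "g \<in> G" "exponent_coeff n k f I a g"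
      by (auto simp: exponent_lattice_def)
    have "exponent_coeff n k f I (inv\<^bsub>int_lattice k\<^esub> a) (inverse g)"
      by (rule exponent_coeff_uminus[OF g(2) nonzero[OF g(1)]])
        (simp add: int_lattice_simps(3)[OF a])
    moreover have "inverse g \<in> G"
      using subgroup.m_inv_closed[OF assms g(1)] nonzero[OF g(1)] by (simp add: field_units_inv)
    ultimately show "inv\<^bsub>int_lattice k\<^esub> a \<in> exponent_lattice n k f I G"
      using L.inv_closed[OF a] by (auto simp: exponent_lattice_def)
  next
    fix a b assume "a \<in> exponent_lattice n k f I G" "b \<in> exponent_lattice n k f I G"
    then obtain g h where ab: "a \<in> carrier (int_lattice k)" "b \<in> carrier (int_lattice k)"
      and gh: "g \<in> G" "exponent_coeff n k f I a g" "h \<in> G" "exponent_coeff n k f I b h"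
      by (auto simp: exponent_lattice_def)
    have "exponent_coeff n k f I (a \<otimes>\<^bsub>int_lattice k\<^esub> b) (g * h)"
      by (rule exponent_coeff_add[OF gh(2,4)]) (simp add: int_lattice_simps)
    moreover have "g * h \<in> G"
      using subgroup.m_closed[OF assms gh(1,3)] by (simp add: field_units_simps)
    ultimately show "a \<otimes>\<^bsub>int_lattice k\<^esub> b \<in> exponent_lattice n k f I G"
      using L.m_closed[OF ab] by (auto simp: exponent_lattice_def)
  qed
qed

lemma exponent_coeff_ex1:
  assumes "a \<in> exponent_lattice n k f I G"
  shows "\<exists>!g. g \<in> G \<and> exponent_coeff n k f I a g"
  using assms exponent_coeff_unique by (auto simp: exponent_lattice_def)

lemma exponent_character_eq:
  assumes "g \<in> G" "exponent_coeff n k f I a g"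
  shows "exponent_character n k f I G a = g"
  unfolding exponent_character_def using assms exponent_coeff_unique by blast

lemma group_hom_exponent_character:
  assumes "subgroup G field_units"
  shows "group_hom (int_lattice k\<lparr>carrier := exponent_lattice n k f I G\<rparr>)
    (field_units\<lparr>carrier := G\<rparr>) (exponent_character n k f I G)"
proof (intro group_hom.intro group_hom_axioms.intro homI)
  show "group (int_lattice k\<lparr>carrier := exponent_lattice n k f I G\<rparr>)"
    by (rule subgroup.subgroup_is_group[OF subgroup_exponent_lattice[OF assms] group_int_lattice])
  show "group (field_units\<lparr>carrier := G\<rparr>)"
    by (rule subgroup.subgroup_is_group[OF assms group_field_units])
next
  fix a assume "a \<in> carrier (int_lattice k\<lparr>carrier := exponent_lattice n k f I G\<rparr>)"
  then show "exponent_character n k f I G a \<in> carrier (field_units\<lparr>carrier := G\<rparr>)"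
    using exponent_character_eq by (auto simp: exponent_lattice_def)
next
  fix a b
  assume "a \<in> carrier (int_lattice k\<lparr>carrier := exponent_lattice n k f I G\<rparr>)"
    and "b \<in> carrier (int_lattice k\<lparr>carrier := exponent_lattice n k f I G\<rparr>)"
  then obtain g h where gh: "g \<in> G" "exponent_coeff n k f I a g" "h \<in> G" "exponent_coeff n k f I b h"
    by (auto simp: exponent_lattice_def)
  have "exponent_coeff n k f I (a \<otimes>\<^bsub>int_lattice k\<^esub> b) (g * h)"
    by (rule exponent_coeff_add[OF gh(2,4)]) (simp add: int_lattice_simps)
  moreover have "g * h \<in> G"
    using subgroup.m_closed[OF assms gh(1,3)] by (simp add: field_units_simps)
  ultimately show "exponent_character n k f I G
      (a \<otimes>\<^bsub>int_lattice k\<lparr>carrier := exponent_lattice n k f I G\<rparr>\<^esub> b)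
    = exponent_character n k f I G a \<otimes>\<^bsub>field_units\<lparr>carrier := G\<rparr>\<^esub> exponent_character n k f I G b"
    using gh by (simp add: exponent_character_eq field_units_simps)
qed

end

theorem proposition4p1:
  fixes n k :: nat
    and f :: "nat \<Rightarrow> 'a::field mpoly"
    and I :: "'a mpoly set"
    and G :: "'a set"
  assumes "f \<in> {1..k} \<rightarrow> carrier (mpoly_ring n)"
    and "ideal I (mpoly_ring n)"
    and "I \<noteq> carrier (mpoly_ring n)"
    and "subgroup G field_units"
  shows
    "(saturation (mpoly_ring n) I (\<Otimes>\<^bsub>mpoly_ring n\<^esub>i \<in> {1..k}. f i) = I
        \<longrightarrow> residues_non_zerodivisors (mpoly_ring n) k f I)
   \<and> (residues_non_zerodivisors (mpoly_ring n) k f I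
        \<longrightarrow> subgroup (exponent_lattice n k f I G) (int_lattice k))
   \<and> (residues_non_zerodivisors (mpoly_ring n) k f I
        \<longrightarrow> (\<forall>a \<in> exponent_lattice n k f I G. \<exists>!g. g \<in> G \<and> exponent_coeff n k f I a g)
          \<and> group_hom (int_lattice k\<lparr>carrier := exponent_lattice n k f I G\<rparr>)
              (field_units\<lparr>carrier := G\<rparr>) (exponent_character n k f I G))"
proof (intro conjI impI)
  assume "saturation (mpoly_ring n) I (\<Otimes>\<^bsub>mpoly_ring n\<^esub>i \<in> {1..k}. f i) = I"
  then show "residues_non_zerodivisors (mpoly_ring n) k f I"
    by (rule residues_non_zerodivisors_if_saturated[OF cring_mpoly_ring assms(2,1)])
next
  assume "residues_non_zerodivisors (mpoly_ring n) k f I"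
  then have tuple: "cancellable_tuple n k f I"
    by (rule cancellable_tuple.intro[OF assms(1-3)])
  show "subgroup (exponent_lattice n k f I G) (int_lattice k)"
    by (rule cancellable_tuple.subgroup_exponent_lattice[OF tuple assms(4)])
  show "\<forall>a \<in> exponent_lattice n k f I G. \<exists>!g. g \<in> G \<and> exponent_coeff n k f I a g"
    using cancellable_tuple.exponent_coeff_ex1[OF tuple] by blast
  show "group_hom (int_lattice k\<lparr>carrier := exponent_lattice n k f I G\<rparr>)
      (field_units\<lparr>carrier := G\<rparr>) (exponent_character n k f I G)"
    by (rule cancellable_tuple.group_hom_exponent_character[OF tuple assms(4)])
qed

end
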